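(* Let $A$ be a unital commutative algebra over a field $\mathbb K$ of characteristic zero, and consider a single variable $x$. Then the group $(G^1,\bullet)$, where $G^1=\{f\in A[[x]] : f(0)=1_A\}$ and $(f\bullet g)(x)=g(x)f(xg(x))$, is isomorphic to the group $G^c=\{h\in A[[x]] : h=x+\sum_{n\ge 2}h_nx^n\}$ of tangent-to-identity formal diffeomorphisms, with group law the composition $(h,k)\mapsto h(k(x))$ of formal power series.
   Context: $f(xg(x))$ denotes the substitution of $xg(x)$ for $x$ in the power series $f$. This is the one-variable instance of the shifted composition law $\bullet$. *)

theory Defs
  imports "HOL-Computational_Algebra.Formal_Power_Series" "HOL-Algebra.Group"
begin

unbundle fps_syntax

text \<open>
  Compatibility with the right factor follows from commutativity. Since \<^class>\<open>comm_ring_1\<close> contains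
  \<open>0 \<noteq> 1\<close>, the zero algebra is excluded.
\<close>
locale unital_comm_algebra = vector_space scale
  for scale :: "'k::field \<Rightarrow> 'a::comm_ring_1 \<Rightarrow> 'a" +
  assumes scale_mult_left: "scale c (a * b) = scale c a * b"

text \<open>
  \<open>(f \<bullet> g)(x) = g(x) f(x g(x))\<close>. The inner series \<open>x g(x)\<close> has zero constant term, so
  \<^const>\<open>fps_compose\<close> is the genuine substitution here; likewise on the carrier of \<open>Gc\<close> below.
\<close>
definition shifted_comp :: "'a::comm_ring_1 fps \<Rightarrow> 'a fps \<Rightarrow> 'a fps"
  where "shifted_comp f g = g * (f oo (fps_X * g))"

definition G1 :: "'a::comm_ring_1 fps monoid"
  where "G1 = \<lparr>carrier = {f. f $ 0 = 1}, monoid.mult = shifted_comp, one = 1\<rparr>"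

definition Gc :: "'a::comm_ring_1 fps monoid"
  where "Gc = \<lparr>carrier = {h. h $ 0 = 0 \<and> h $ 1 = 1}, monoid.mult = fps_compose, one = fps_X\<rparr>"

end

theory Submission imports Defs
begin

text \<open>
  The map \<open>f \<mapsto> x f(x)\<close> turns the shifted composition into ordinary composition, because
  \<open>(x f) \<circ> (x g) = x g(x) f(x g(x))\<close>. Hence it suffices that the formal diffeomorphisms form a
  group; the structure on \<open>G1\<close> is then transported along the inverse map \<open>h \<mapsto> h / x\<close>.

  The library proves multiplicativity and associativity of \<^const>\<open>fps_compose\<close> only over
  integral domains, and the existence of compositional inverses only over fields; the versions
  below hold over any commutative ring.
\<close>

text \<open>Since \<open>c\<close> has no constant term, \<open>c ^ i\<close> has no terms below
  degree i, so the summands with i > n vanish. A common bound \<open>N\<close> lets sums for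
  different coefficients be interchanged.\<close>

lemma fps_compose_nth_extend:
  fixes c :: "'a::comm_ring_1 fps"
  assumes "c $ 0 = 0" and "n \<le> N"
  shows "(a oo c) $ n = (\<Sum>i\<le>N. a $ i * (c ^ i) $ n)"
  unfolding fps_compose_nth using assms
  by (intro sum.mono_neutral_left) (auto simp: startsby_zero_power_prefix)

lemma fps_compose_mult_distrib_comm_ring:
  fixes a b c :: "'a::comm_ring_1 fps"
  assumes c0: "c $ 0 = 0"
  shows "(a * b) oo c = (a oo c) * (b oo c)"
proof (rule fps_ext)
  fix n
  let ?g = "\<lambda>i j. a $ i * b $ j * (c ^ (i + j)) $ n"
  have "((a oo c) * (b oo c)) $ n =
      (\<Sum>k=0..n. (\<Sum>i\<le>n. a $ i * (c ^ i) $ k) * (\<Sum>j\<le>n. b $ j * (c ^ j) $ (n - k)))"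
    unfolding fps_mult_nth
    by (intro sum.cong refl arg_cong2[where f = "(*)"] fps_compose_nth_extend c0) auto
  also have "\<dots> = (\<Sum>k=0..n. \<Sum>i\<le>n. \<Sum>j\<le>n. a $ i * b $ j * ((c ^ i) $ k * (c ^ j) $ (n - k)))"
    by (simp add: sum_product ac_simps)
  also have "\<dots> = (\<Sum>i\<le>n. \<Sum>k=0..n. \<Sum>j\<le>n. a $ i * b $ j * ((c ^ i) $ k * (c ^ j) $ (n - k)))"
    by (rule sum.swap)
  also have "\<dots> = (\<Sum>i\<le>n. \<Sum>j\<le>n. \<Sum>k=0..n. a $ i * b $ j * ((c ^ i) $ k * (c ^ j) $ (n - k)))"
    by (intro sum.cong refl sum.swap)
  also have "\<dots> = (\<Sum>i\<le>n. \<Sum>j\<le>n. ?g i j)"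
    by (simp add: power_add fps_mult_nth sum_distrib_left)
  also have "\<dots> = (\<Sum>(i, j)\<in>{..n} \<times> {..n}. ?g i j)"
    by (rule sum.cartesian_product)
  \<comment> \<open>Outside this triangle \<open>c ^ (i + j)\<close> has no term of degree n; its
    antidiagonals give the Cauchy product.\<close>
  also have "\<dots> = (\<Sum>(i, j)\<in>{(i, j). i + j \<le> n}. ?g i j)"
  proof (intro sum.mono_neutral_right ballI)
    fix p
    assume "p \<in> {..n} \<times> {..n} - {(i, j). i + j \<le> n}"
    then show "(case p of (i, j) \<Rightarrow> ?g i j) = 0"
      by (cases p) (simp add: startsby_zero_power_prefix[OF c0])
  qed auto
  also have "\<dots> = (\<Sum>s\<le>n. \<Sum>i\<le>s. ?g i (s - i))"
    by (rule sum.triangle_reindex_eq)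
  also have "\<dots> = ((a * b) oo c) $ n"
    by (simp add: fps_compose_nth fps_mult_nth sum_distrib_right atLeast0AtMost)
  finally show "((a * b) oo c) $ n = ((a oo c) * (b oo c)) $ n" ..
qed

lemma fps_compose_power_comm_ring:
  fixes a c :: "'a::comm_ring_1 fps"
  assumes "c $ 0 = 0"
  shows "(a ^ n) oo c = (a oo c) ^ n"
  by (induction n) (simp_all add: fps_compose_mult_distrib_comm_ring assms)

lemma fps_compose_assoc_comm_ring:
  fixes a b c :: "'a::comm_ring_1 fps"
  assumes b0: "b $ 0 = 0" and c0: "c $ 0 = 0"
  shows "a oo (b oo c) = (a oo b) oo c"
proof (rule fps_ext)
  fix n
  have "(a oo (b oo c)) $ n = (\<Sum>i\<le>n. a $ i * ((b ^ i) oo c) $ n)"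
    by (simp add: fps_compose_nth[of a] fps_compose_power_comm_ring c0 atLeast0AtMost)
  also have "\<dots> = (\<Sum>i\<le>n. \<Sum>j\<le>n. a $ i * (b ^ i) $ j * (c ^ j) $ n)"
    by (simp add: fps_compose_nth atLeast0AtMost sum_distrib_left mult.assoc)
  also have "\<dots> = (\<Sum>j\<le>n. \<Sum>i\<le>n. a $ i * (b ^ i) $ j * (c ^ j) $ n)"
    by (rule sum.swap)
  \<comment> \<open>The sum for \<open>(a oo b) $ j\<close> stops at j by definition; it is extended
    to n.\<close>
  also have "\<dots> = (\<Sum>j\<le>n. (a oo b) $ j * (c ^ j) $ n)"
    by (intro sum.cong refl) (simp add: fps_compose_nth_extend[OF b0] sum_distrib_right)
  also have "\<dots> = ((a oo b) oo c) $ n"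
    by (simp add: fps_compose_nth[of "a oo b"] atLeast0AtMost)
  finally show "(a oo (b oo c)) $ n = ((a oo b) oo c) $ n" .
qed

text \<open>
  Coefficients of the series \<open>k\<close> with \<open>k \<circ> a = b\<close>: the coefficient of \<open>x\<^sup>n\<close> in \<open>k \<circ> a\<close> is
  \<open>k\<^sub>n (a\<^sub>1)\<^sup>n\<close> plus terms that involve only \<open>k\<^sub>i\<close> with \<open>i < n\<close>. The argument \<open>u\<close> is the inverse
  of \<open>a\<^sub>1\<close>.
\<close>
fun left_factor_coeff :: "'a::comm_ring_1 \<Rightarrow> 'a fps \<Rightarrow> 'a fps \<Rightarrow> nat \<Rightarrow> 'a" where
  "left_factor_coeff u b a n = u ^ n * (b $ n - (\<Sum>i<n. left_factor_coeff u b a i * (a ^ i) $ n))"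

declare left_factor_coeff.simps [simp del]

text \<open>The triangular system for \<open>k\<close> is solvable because its diagonal entries
  \<open>(a ^ n) $ n = (a $ 1) ^ n\<close> are units. For \<open>b = fps_X\<close> this gives a left
  inverse, which is all that \<open>groupI\<close> asks for.\<close>

lemma fps_compose_left_factor_exists:
  fixes a b :: "'a::comm_ring_1 fps"
  assumes a0: "a $ 0 = 0" and a1: "a $ 1 dvd 1"
  shows "\<exists>k. k oo a = b"
proof -
  obtain u where u: "a $ 1 * u = 1"
    using a1 by (metis dvdE)
  let ?k = "left_factor_coeff u b a"
  have "(Abs_fps ?k oo a) $ n = b $ n" for n
  proof -
    have "(a ^ n) $ n * u ^ n = 1"
      by (simp add: startsby_zero_power_nth_same[OF a0] power_mult_distrib[symmetric] u[simplified])
    moreover have "?k n * (a ^ n) $ n =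
        ((a ^ n) $ n * u ^ n) * (b $ n - (\<Sum>i<n. ?k i * (a ^ i) $ n))"
      by (subst left_factor_coeff.simps) (simp only: ac_simps)
    moreover have "(Abs_fps ?k oo a) $ n = (\<Sum>i<n. ?k i * (a ^ i) $ n) + ?k n * (a ^ n) $ n"
      by (simp add: fps_compose_nth atLeast0AtMost lessThan_Suc_atMost[symmetric])
    ultimately show ?thesis
      by simp
  qed
  then show ?thesis
    by (blast intro: fps_ext)
qed

lemma fps_compose_nth_1:
  fixes f g :: "'a::comm_ring_1 fps"
  shows "(f oo g) $ 1 = f $ 1 * g $ 1"
  by (simp add: fps_compose_nth)

lemma group_Gc: "group (Gc :: 'a::comm_ring_1 fps monoid)"
proof (rule groupI)
  fix f g :: "'a fps"
  assume "f \<in> carrier Gc" "g \<in> carrier Gc"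
  then show "f \<otimes>\<^bsub>Gc\<^esub> g \<in> carrier Gc"
    using fps_compose_nth_1[of f g] by (simp add: Gc_def)
next
  fix f g h :: "'a fps"
  assume "f \<in> carrier Gc" "g \<in> carrier Gc" "h \<in> carrier Gc"
  then show "f \<otimes>\<^bsub>Gc\<^esub> g \<otimes>\<^bsub>Gc\<^esub> h = f \<otimes>\<^bsub>Gc\<^esub> (g \<otimes>\<^bsub>Gc\<^esub> h)"
    by (simp add: Gc_def fps_compose_assoc_comm_ring)
next
  fix f :: "'a fps"
  assume f: "f \<in> carrier Gc"
  then obtain k where k: "k oo f = fps_X"
    using fps_compose_left_factor_exists[of f fps_X] by (auto simp: Gc_def)
  moreover have "k $ 0 = 0" "k $ 1 = 1"
    using fps_compose_nth_0[of k f] fps_compose_nth_1[of k f] f by (simp_all add: k Gc_def)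
  ultimately show "\<exists>g\<in>carrier Gc. g \<otimes>\<^bsub>Gc\<^esub> f = \<one>\<^bsub>Gc\<^esub>"
    by (auto simp: Gc_def)
qed (auto simp: Gc_def)

lemma fps_shift_compose:
  fixes h k :: "'a::comm_ring_1 fps"
  assumes "h $ 0 = 0" and "k $ 0 = 0"
  shows "fps_shift 1 (h oo k) = shifted_comp (fps_shift 1 h) (fps_shift 1 k)"
proof -
  have X: "fps_X * fps_shift 1 f = f" if "f $ 0 = 0" for f :: "'a fps"
    using that by (intro fps_ext) simp
  \<comment> \<open>Write h as x times its shift and compose factor by factor.\<close>
  have "h oo k = k * (fps_shift 1 h oo k)"
    using fps_compose_mult_distrib_comm_ring[OF assms(2), of fps_X "fps_shift 1 h"]
    by (simp only: X assms fps_X_fps_compose_startby0)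
  also have "\<dots> = fps_X * (fps_shift 1 k * (fps_shift 1 h oo k))"
    by (simp only: X assms mult.assoc[symmetric])
  finally show ?thesis
    by (simp only: shifted_comp_def X assms) (intro fps_ext, simp)
qed

lemma fps_shift_iso: "fps_shift 1 \<in> iso (Gc :: 'a::comm_ring_1 fps monoid) G1"
proof (rule isoI)
  show "fps_shift 1 \<in> hom (Gc :: 'a fps monoid) G1"
    using fps_shift_compose by (auto simp: hom_def Gc_def G1_def)
  show "bij_betw (fps_shift 1) (carrier (Gc :: 'a fps monoid)) (carrier G1)"
    by (rule bij_betw_byWitness[where f' = "\<lambda>f. fps_X * f"])
      (auto simp: Gc_def G1_def intro!: fps_ext)
qed

theorem corollary2p3:
  fixes scale :: "'k::field_char_0 \<Rightarrow> 'a::comm_ring_1 \<Rightarrow> 'a"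
  assumes "unital_comm_algebra scale"
  shows "group (G1 :: 'a fps monoid) \<and> group (Gc :: 'a fps monoid)
         \<and> (G1 :: 'a fps monoid) \<cong> (Gc :: 'a fps monoid)"
proof -
  \<comment> \<open>Transport along the isomorphism makes the image of \<open>fps_X\<close> the
    unit; this identifies it with the unit of \<open>G1\<close>.\<close>
  have "fps_shift 1 (fps_X :: 'a fps) = 1"
    by (rule fps_ext) simp
  then have "group (G1 :: 'a fps monoid)"
    using group.iso_imp_img_group[OF group_Gc fps_shift_iso] by (simp add: Gc_def G1_def)
  moreover have "(G1 :: 'a fps monoid) \<cong> (Gc :: 'a fps monoid)"
    by (rule group.iso_sym[OF group_Gc is_isoI[OF fps_shift_iso]])
  ultimately show ?thesis
    using group_Gc by blast
qed

end
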